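(* For the functions $|\cdot|^p:\mathbb{R}\to\mathbb{R}$ the following hold. (i) $\alpha(|\cdot|^p)>(2p)^{-1}$ for all $p\in(2,\infty)$. (ii) For any $c\in(0,2)$ there exists a $P\in(2,\infty)$ such that $p\in(P,\infty)$ implies $\alpha(|\cdot|^p)<(cp)^{-1}$. (iii) $\alpha(|\cdot|^p)\sim(2p)^{-1}$ as $p\to\infty$.
   Context: For a differentiable strictly convex function $h:\mathbb{R}\to\mathbb{R}$ (such as $|\cdot|^p$ with $p>1$), the Bregman distance is $D_h(x,y):=h(x)-h(y)-h'(y)(x-y)$ and the symmetry coefficient is $$\alpha(h):=\inf\left\{\frac{D_h(x,y)}{D_h(y,x)}\;\middle|\;x,y\in\mathbb{R},\ x\neq y\right\}.$$ The notation $a(p)\sim b(p)$ as $p\to\infty$ means $\lim_{p\to\infty}a(p)/b(p)=1$. *)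

theory Defs
  imports "HOL-Analysis.Analysis" "HOL-Library.Landau_Symbols"
begin

text \<open>
  Both definitions are total, but they have their intended meaning only for a differentiable
  strictly convex \<open>h\<close>. For such \<open>h\<close> we have \<open>bregman h x y > 0\<close> whenever \<open>x \<noteq> y\<close>, so the quotients
  below are not divisions by zero, and they form a nonempty set of reals that is bounded below
  by 0; hence the real-valued \<open>Inf\<close> is the true infimum.
\<close>

definition bregman :: "(real \<Rightarrow> real) \<Rightarrow> real \<Rightarrow> real \<Rightarrow> real" where
  "bregman h x y = h x - h y - deriv h y * (x - y)"

definition symmetry_coeff :: "(real \<Rightarrow> real) \<Rightarrow> real" where
  "symmetry_coeff h = Inf {bregman h x y / bregman h y x | x y. x \<noteq> y}"

definition abs_power :: "real \<Rightarrow> real \<Rightarrow> real" where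
  "abs_power p x = \<bar>x\<bar> powr p"

end

theory Submission
  imports Defs "HOL-Real_Asymp.Real_Asymp"
begin

text \<open>
  Write \<open>D\<^sub>p\<close> for the Bregman distance of \<open>\<bar>\<cdot>\<bar>\<^sup>p\<close>. Everything follows from a sharp
  enough pair of bounds on the symmetry coefficient, namely \<open>1 / (2p - 1)\<close> from below and the
  quotient of one well-chosen pair of points from above.

  Lower bound. For \<open>x\<close> and \<open>y\<close> of the same sign, the combination
  \<open>(2p - 1) D\<^sub>p(x, y) - D\<^sub>p(y, x)\<close> equals \<open>p (D\<^sub>p(x, y) + \<bar>y\<bar> D\<^bsub>p-1\<^esub>(x, y))\<close>, as expanding
  both sides shows; it is nonnegative because both powers, \<open>p\<close> and \<open>p - 1\<close>, exceed 1, so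
  that both distances come from convex functions. For opposite signs all terms of the expansion
  are nonnegative except \<open>- p \<bar>x\<bar>\<^bsup>p-1\<^esup> \<bar>y\<bar>\<close>, which is dominated by
  \<open>p (\<bar>x\<bar>\<^sup>p + \<bar>y\<bar>\<^sup>p)\<close>. Hence every quotient is at least \<open>1 / (2p - 1)\<close>
  (\<open>bregman_abs_power_ratio_ge\<close>). A bound that is uniform in \<open>x\<close> and \<open>y\<close> and strictly larger than
  \<open>1 / (2p)\<close> is what makes the inequality for the infimum strict.

  Upper bound. At the points \<open>-s\<close> and \<open>1\<close> the quotient is
  \<open>(s\<^sup>p + p - 1 + p s) / (1 + (p - 1) s\<^sup>p + p s\<^bsup>p-1\<^esup>)\<close>. It is close to \<open>1 / (2p)\<close> when \<open>s\<close> is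
  close to 1 while \<open>s\<^sup>p\<close> is much larger than \<open>p\<close>: the powers of \<open>s\<close> then dominate, and the two in
  the denominator contribute about \<open>p s\<^sup>p\<close> each. The choice \<open>s\<^sup>p = p\<^sup>2\<close> meets both requirements,
  since \<open>p\<^bsup>2/p\<^esup>\<close> tends to 1.

  The two bounds squeeze \<open>2p\<close> times the coefficient to 1
  (\<open>symmetry_coeff_abs_power_scaled_limit\<close>), which is the asymptotic equivalence and also gives the
  upper estimate with any \<open>c < 2\<close>, because then \<open>2 / c > 1\<close>.
\<close>

section \<open>Bregman distances of power functions\<close>

text \<open>
  By the mean value theorem \<open>h x - h y = h' z (x - y)\<close> with \<open>z\<close> strictly between the two points, and
  replacing \<open>h' z\<close> by \<open>h' y\<close> strictly lowers the right-hand side, whichever point is the larger one.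
\<close>

lemma bregman_pos:
  assumes deriv: "\<And>z. (h has_real_derivative h' z) (at z)" and mono: "strict_mono h'"
    and "x \<noteq> y"
  shows "bregman h x y > 0"
proof -
  have breg: "bregman h x y = h x - h y - h' y * (x - y)"
    by (simp add: bregman_def DERIV_imp_deriv[OF deriv])
  show ?thesis
  proof (cases "x < y")
    case True
    then obtain z where "x < z" "z < y" and z: "h y - h x = (y - x) * h' z"
      using MVT2[of x y h h'] deriv by blast
    then have "h' z < h' y" using mono by (simp add: strict_mono_less)
    then have "(y - x) * h' z < (y - x) * h' y" using True by simp
    with z show ?thesis by (simp add: breg algebra_simps)
  next
    case False
    with \<open>x \<noteq> y\<close> have "y < x" by simp
    then obtain z where "y < z" "z < x" and z: "h x - h y = (x - y) * h' z"
      using MVT2[of y x h h'] deriv by blast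
    then have "h' y < h' z" using mono by (simp add: strict_mono_less)
    then have "(x - y) * h' y < (x - y) * h' z" using \<open>y < x\<close> by simp
    with z show ?thesis by (simp add: breg algebra_simps)
  qed
qed

text \<open>
  Away from 0 this is the chain rule. At 0 the difference quotient has absolute value
  \<open>\<bar>h\<bar> powr (p - 1)\<close>, which vanishes in the limit since \<open>p > 1\<close>.
\<close>

lemma has_real_derivative_abs_power:
  assumes "p > 1"
  shows "(abs_power p has_real_derivative p * (sgn x * \<bar>x\<bar> powr (p - 1))) (at x)"
proof (cases "x = 0")
  case True
  have "((\<lambda>h. \<bar>h\<bar> powr (p - 1)) \<longlongrightarrow> 0) (at (0::real))"
    using assms by (intro tendsto_zero_powrI[where b = "p - 1"] tendsto_rabs_zero
        tendsto_ident_at tendsto_const) auto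
  moreover have "\<bar>\<bar>h\<bar> powr p / h\<bar> = \<bar>h\<bar> powr (p - 1)" for h :: real
    by (cases "h = 0") (simp_all add: powr_diff)
  ultimately have "((\<lambda>h. \<bar>\<bar>h\<bar> powr p / h\<bar>) \<longlongrightarrow> 0) (at (0::real))"
    by (simp only:)
  then have "((\<lambda>h. \<bar>h\<bar> powr p / h) \<longlongrightarrow> 0) (at (0::real))"
    by (rule tendsto_rabs_zero_cancel)
  then have "((\<lambda>x. \<bar>x\<bar> powr p) has_real_derivative 0) (at 0)"
    by (simp add: DERIV_def)
  then show ?thesis
    unfolding abs_power_def using True by simp
next
  case False
  \<comment> \<open>The absolute value agrees with multiplication by \<open>sgn x\<close> on the half-line containing \<open>x\<close>.\<close>
  have "(abs has_real_derivative sgn x) (at x)"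
  proof (rule has_field_derivative_transform_within_open)
    show "((*) (sgn x) has_real_derivative sgn x) (at x)"
      by (rule DERIV_cmult_Id)
    show "open {z. 0 < sgn x * z}"
      by (intro open_Collect_less continuous_intros)
    show "x \<in> {z. 0 < sgn x * z}" using False by (simp add: sgn_if)
    show "sgn x * z = \<bar>z\<bar>" if "z \<in> {z. 0 < sgn x * z}" for z
      using that False by (simp add: sgn_if split: if_splits)
  qed
  from DERIV_fun_powr[OF this, of p] False
  have "((\<lambda>x. \<bar>x\<bar> powr p) has_real_derivative p * (sgn x * \<bar>x\<bar> powr (p - 1))) (at x)"
    by (simp add: mult_ac)
  then show ?thesis unfolding abs_power_def .
qed

lemma strict_mono_sgn_powr:
  assumes "q > 0"
  shows "strict_mono (\<lambda>x::real. sgn x * \<bar>x\<bar> powr q)"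
proof (rule strict_monoI)
  fix x y :: real
  assume "x < y"
  then consider "0 \<le> x" | "y \<le> 0" | "x < 0" "0 < y" by linarith
  then show "sgn x * \<bar>x\<bar> powr q < sgn y * \<bar>y\<bar> powr q"
  proof cases
    case 1
    with \<open>x < y\<close> assms have "x powr q < y powr q" by (intro powr_less_mono2) auto
    with 1 \<open>x < y\<close> show ?thesis by (auto simp: sgn_if)
  next
    case 2
    with \<open>x < y\<close> assms have "(-y) powr q < (-x) powr q" by (intro powr_less_mono2) auto
    with 2 \<open>x < y\<close> show ?thesis by (auto simp: sgn_if)
  next
    case 3
    have "sgn x * \<bar>x\<bar> powr q < 0" "0 < sgn y * \<bar>y\<bar> powr q"
      using 3 by (auto simp: sgn_if)
    then show ?thesis by linarith
  qed
qed

lemma bregman_abs_power_pos: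
  assumes "p > 1" "x \<noteq> y"
  shows "bregman (abs_power p) x y > 0"
proof (rule bregman_pos)
  show "(abs_power p has_real_derivative p * (sgn z * \<bar>z\<bar> powr (p - 1))) (at z)" for z
    by (rule has_real_derivative_abs_power[OF assms(1)])
  show "strict_mono (\<lambda>x. p * (sgn x * \<bar>x\<bar> powr (p - 1)))"
  proof (rule strict_monoI)
    fix u v :: real
    assume "u < v"
    with assms(1) have "sgn u * \<bar>u\<bar> powr (p - 1) < sgn v * \<bar>v\<bar> powr (p - 1)"
      by (intro strict_monoD[OF strict_mono_sgn_powr]) simp_all
    with assms(1) show "p * (sgn u * \<bar>u\<bar> powr (p - 1)) < p * (sgn v * \<bar>v\<bar> powr (p - 1))"
      by (intro mult_strict_left_mono) simp_all
  qed
  show "x \<noteq> y" by (fact assms(2))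
qed

lemma bregman_abs_power:
  assumes "p > 1"
  shows "bregman (abs_power p) x y =
    \<bar>x\<bar> powr p + (p - 1) * \<bar>y\<bar> powr p - p * (sgn y * \<bar>y\<bar> powr (p - 1)) * x"
proof -
  have base: "sgn y * \<bar>y\<bar> powr (p - 1) * y = \<bar>y\<bar> powr p"
  proof -
    have "sgn y * y = \<bar>y\<bar>" by (simp add: sgn_if)
    then have "sgn y * \<bar>y\<bar> powr (p - 1) * y = \<bar>y\<bar> * \<bar>y\<bar> powr (p - 1)"
      by (metis mult.assoc mult.commute)
    also have "\<dots> = \<bar>y\<bar> powr p"
      using powr_mult_base[of "\<bar>y\<bar>" "p - 1"] by simp
    finally show ?thesis .
  qed
  have deriv: "deriv (abs_power p) y = p * (sgn y * \<bar>y\<bar> powr (p - 1))"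
    by (rule DERIV_imp_deriv[OF has_real_derivative_abs_power[OF assms]])
  have ring: "X - Y - p * S * (x - y) = X + (p - 1) * Y - p * S * x" if "S * y = Y" for X Y S :: real
    by (simp add: that[symmetric] algebra_simps)
  have "bregman (abs_power p) x y =
    \<bar>x\<bar> powr p - \<bar>y\<bar> powr p - p * (sgn y * \<bar>y\<bar> powr (p - 1)) * (x - y)"
    by (simp only: bregman_def deriv abs_power_def)
  also note ring[OF base]
  finally show ?thesis .
qed

text \<open>
  The point of this identity is that the right-hand side shows positivity: the first two summands
  are Bregman distances of convex functions, and the last one vanishes unless \<open>x\<close> and \<open>y\<close> have
  opposite signs.
\<close>

lemma bregman_abs_power_combination:
  assumes "p > 2"
  shows "(2 * p - 1) * bregman (abs_power p) x y - bregman (abs_power p) y x =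
    p * (bregman (abs_power p) x y + \<bar>y\<bar> * bregman (abs_power (p - 1)) x y
      - \<bar>x\<bar> powr (p - 1) * (\<bar>y\<bar> - sgn x * y))"
proof -
  have y: "\<bar>y\<bar> * \<bar>y\<bar> powr (p - 1) = \<bar>y\<bar> powr p" "\<bar>y\<bar> * \<bar>y\<bar> powr (p - 2) = \<bar>y\<bar> powr (p - 1)"
    using powr_mult_base[of "\<bar>y\<bar>" "p - 1"] powr_mult_base[of "\<bar>y\<bar>" "p - 2"] by simp_all
  have expand:
    "bregman (abs_power p) x y =
      \<bar>x\<bar> powr p + (p - 1) * \<bar>y\<bar> powr p - p * (sgn y * \<bar>y\<bar> powr (p - 1)) * x"
    "bregman (abs_power p) y x =
      \<bar>y\<bar> powr p + (p - 1) * \<bar>x\<bar> powr p - p * (sgn x * \<bar>x\<bar> powr (p - 1)) * y"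
    "bregman (abs_power (p - 1)) x y =
      \<bar>x\<bar> powr (p - 1) + (p - 2) * \<bar>y\<bar> powr (p - 1) - (p - 1) * (sgn y * \<bar>y\<bar> powr (p - 2)) * x"
    using assms bregman_abs_power[of p x y] bregman_abs_power[of p y x]
      bregman_abs_power[of "p - 1" x y] by simp_all
  \<comment> \<open>The identity is polynomial once the powers of \<open>\<bar>x\<bar>\<close> and \<open>\<bar>y\<bar>\<close> and the signs are treated as
    independent quantities; only the relations between successive powers of \<open>\<bar>y\<bar>\<close> enter.\<close>
  have ring: "(2 * p - 1) * (xp + (p - 1) * yp - p * (s * y1) * x) - (yp + (p - 1) * xp - p * (t * x1) * y)
      = p * ((xp + (p - 1) * yp - p * (s * y1) * x) + a * (x1 + (p - 2) * y1 - (p - 1) * (s * y2) * x)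
        - x1 * (a - t * y))"
    if "a * y1 = yp" "a * y2 = y1" for a x y xp yp x1 y1 y2 s t :: real
    unfolding that(1)[symmetric] that(2)[symmetric] by algebra
  show ?thesis
    unfolding expand using y by (rule ring)
qed

text \<open>
  For equal signs the combination identity gives the claim. For opposite signs it has a
  negative contribution, so the expansion is used directly: its only negative term is
  \<open>a powr (p - 1) * b\<close>, and this is at most \<open>a powr p\<close> or at most \<open>b powr p\<close>, according to which of
  \<open>a\<close> and \<open>b\<close> is larger. The coefficient \<open>2p - 3\<close> of \<open>b powr p\<close> is at least 1.
\<close>

lemma bregman_abs_power_swap_le:
  assumes "p > 2"
  shows "bregman (abs_power p) y x \<le> (2 * p - 1) * bregman (abs_power p) x y"
proof (cases "x * y \<ge> 0")
  case True
  have nonneg: "bregman (abs_power q) x y \<ge> 0" if "q > 1" for q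
    using bregman_abs_power_pos[OF that, of x y]
    by (cases "x = y") (auto simp: bregman_def)
  have "\<bar>x\<bar> powr (p - 1) * (\<bar>y\<bar> - sgn x * y) = 0"
    using True by (auto simp: sgn_if zero_le_mult_iff)
  then have "(2 * p - 1) * bregman (abs_power p) x y - bregman (abs_power p) y x =
    p * (bregman (abs_power p) x y + \<bar>y\<bar> * bregman (abs_power (p - 1)) x y)"
    using bregman_abs_power_combination[OF assms, of x y] by simp
  also have "\<dots> \<ge> 0" using nonneg assms by simp
  finally show ?thesis by simp
next
  case False
  define a b where "a = \<bar>x\<bar>" and "b = \<bar>y\<bar>"
  have ab: "a > 0" "b > 0" using False by (auto simp: a_def b_def)
  have sgn: "sgn x * y = - b" "sgn y * x = - a"
    using False by (auto simp: a_def b_def sgn_if mult_less_0_iff not_le)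
  have pow: "a powr p = a * a powr (p - 1)" "b powr p = b * b powr (p - 1)"
    using ab by (simp_all add: powr_diff)
  have "(2 * p - 1) * bregman (abs_power p) x y - bregman (abs_power p) y x =
     p * (a powr p + (2 * p - 3) * b powr p + (2 * p - 1) * b powr (p - 1) * a
        - a powr (p - 1) * b)"
  proof -
    have ring: "(2 * p - 1) * (ap + (p - 1) * bp - p * b1 * (- a)) - (bp + (p - 1) * ap - p * a1 * (- b))
        = p * (ap + (2 * p - 3) * bp + (2 * p - 1) * b1 * a - a1 * b)" for ap bp a1 b1
      by algebra
    have expand: "bregman (abs_power p) x y = a powr p + (p - 1) * b powr p - p * b powr (p - 1) * (sgn y * x)"
      "bregman (abs_power p) y x = b powr p + (p - 1) * a powr p - p * a powr (p - 1) * (sgn x * y)"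
      using assms by (simp_all add: bregman_abs_power a_def b_def)
    show ?thesis
      unfolding expand sgn by (rule ring)
  qed
  also have "\<dots> \<ge> 0"
  proof -
    have "a powr (p - 1) * b \<le> a powr p + b powr p"
    proof (cases "b \<le> a")
      case True
      then have "a powr (p - 1) * b \<le> a powr p" using ab by (simp add: pow)
      then show ?thesis using powr_ge_zero[of b p] by linarith
    next
      case False
      then have "a powr (p - 1) \<le> b powr (p - 1)"
        using ab assms by (intro powr_mono2) auto
      then have "a powr (p - 1) * b \<le> b powr p" using ab by (simp add: pow)
      then show ?thesis using powr_ge_zero[of a p] by linarith
    qed
    moreover have "b powr p \<le> (2 * p - 3) * b powr p"
      using assms by (intro mult_le_cancel_right1[THEN iffD2]) auto
    moreover have "0 \<le> (2 * p - 1) * b powr (p - 1) * a"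
      using assms ab by simp
    ultimately show ?thesis using assms by (intro mult_nonneg_nonneg) linarith+
  qed
  finally show ?thesis by simp
qed

lemma bregman_abs_power_ratio_ge:
  assumes "p > 2" "x \<noteq> y"
  shows "inverse (2 * p - 1) \<le> bregman (abs_power p) x y / bregman (abs_power p) y x"
proof -
  have "bregman (abs_power p) y x \<le> (2 * p - 1) * bregman (abs_power p) x y"
    by (rule bregman_abs_power_swap_le[OF assms(1)])
  moreover have "bregman (abs_power p) y x > 0"
    using assms by (intro bregman_abs_power_pos) auto
  ultimately have "1 \<le> (2 * p - 1) * (bregman (abs_power p) x y / bregman (abs_power p) y x)"
    by (simp add: le_divide_eq)
  with assms(1) show ?thesis
    by (simp add: inverse_eq_divide divide_le_eq mult.commute)
qed

section \<open>Bounds on the symmetry coefficient\<close>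

lemma symmetry_coeff_abs_power_ge:
  assumes "p > 2"
  shows "inverse (2 * p - 1) \<le> symmetry_coeff (abs_power p)"
  unfolding symmetry_coeff_def
proof (rule cInf_greatest)
  have "(1::real) \<noteq> 0" by simp
  then show "{bregman (abs_power p) x y / bregman (abs_power p) y x |x y. x \<noteq> y} \<noteq> {}"
    by blast
qed (use bregman_abs_power_ratio_ge[OF assms] in auto)

text \<open>
  The right-hand side is the quotient at the points \<open>-s\<close> and \<open>1\<close>. Opposite signs make the
  linear term of the Bregman distance in the denominator add to its power terms; for equal signs
  it would cancel against them.
\<close>

lemma symmetry_coeff_abs_power_le:
  assumes "p > 2" "s > 0"
  shows "symmetry_coeff (abs_power p) \<le>
    (s powr p + (p - 1) + p * s) / (1 + (p - 1) * s powr p + p * s powr (p - 1))"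
proof -
  have "symmetry_coeff (abs_power p) \<le>
      bregman (abs_power p) (- s) 1 / bregman (abs_power p) 1 (- s)"
    unfolding symmetry_coeff_def
  proof (rule cInf_lower)
    have "- s \<noteq> 1" using assms by simp
    then show "bregman (abs_power p) (- s) 1 / bregman (abs_power p) 1 (- s)
        \<in> {bregman (abs_power p) x y / bregman (abs_power p) y x |x y. x \<noteq> y}"
      by blast
    show "bdd_below {bregman (abs_power p) x y / bregman (abs_power p) y x |x y. x \<noteq> y}"
      using bregman_abs_power_ratio_ge[OF assms(1)] by (intro bdd_belowI[of _ "inverse (2 * p - 1)"]) blast
  qed
  then show ?thesis using assms by (simp add: bregman_abs_power)
qed

text \<open>
  This is \<open>2p\<close> times the upper bound for \<open>s = p powr (2 / p)\<close>, that is, for \<open>s powr p = p\<^sup>2\<close>.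
  Dividing numerator and denominator by \<open>p\<^sup>2\<close> and \<open>p\<^sup>3\<close> leaves only terms whose limits are evident:
  the numerator tends to 1, and the denominator to \<open>1 + 1\<close>.
\<close>

lemma test_ratio_limit:
  "((\<lambda>p. (p^2 + (p - 1) + p * p powr (2 / p)) /
      (1 + (p - 1) * p^2 + p * (p^2 / p powr (2 / p))) * (2 * p)) \<longlongrightarrow> (1::real)) at_top"
proof -
  let ?s = "\<lambda>p::real. p powr (2 / p)"
  have s: "(?s \<longlongrightarrow> 1) at_top" by real_asymp
  have "((\<lambda>p. 2 * (1 + (p - 1) / p^2 + ?s p * inverse p) /
      ((1 + (p - 1) * p^2) / p^3 + inverse (?s p))) \<longlongrightarrow> 2 * (1 + 1 * 0) / (1 + inverse 1)) at_top"
  proof (intro tendsto_divide tendsto_mult tendsto_add tendsto_inverse tendsto_const s)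
    show "((\<lambda>p::real. 1 + (p - 1) / p^2) \<longlongrightarrow> 1) at_top" by real_asymp
    show "((\<lambda>p::real. inverse p) \<longlongrightarrow> 0) at_top" by real_asymp
    show "((\<lambda>p::real. (1 + (p - 1) * p^2) / p^3) \<longlongrightarrow> 1) at_top" by real_asymp
  qed simp_all
  moreover have "\<forall>\<^sub>F p in at_top. 2 * (1 + (p - 1) / p^2 + ?s p * inverse p) /
      ((1 + (p - 1) * p^2) / p^3 + inverse (?s p)) =
    (p^2 + (p - 1) + p * ?s p) / (1 + (p - 1) * p^2 + p * (p^2 / ?s p)) * (2 * p)"
    using eventually_gt_at_top[of 0]
  proof eventually_elim
    case (elim p)
    define s where "s = ?s p"
    have "s > 0" using elim by (simp add: s_def)
    have "1 + (p - 1) / p^2 + s * inverse p = (p^2 + (p - 1) + p * s) / p^2"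
      using elim by (simp add: field_simps power2_eq_square)
    moreover have "p * (p^2 / s) / p^3 = inverse s"
      using elim \<open>s > 0\<close> by (simp add: inverse_eq_divide power2_eq_square power3_eq_cube)
    then have "(1 + (p - 1) * p^2) / p^3 + inverse s = (1 + (p - 1) * p^2 + p * (p^2 / s)) / p^3"
      by (simp only: add_divide_distrib)
    moreover have "2 * (N / p^2) / (D / p^3) = N / D * (2 * p)" for N D :: real
      using elim by (simp add: power2_eq_square power3_eq_cube)
    ultimately show ?case unfolding s_def[symmetric] by (simp only:)
  qed
  ultimately have "((\<lambda>p. (p^2 + (p - 1) + p * ?s p) /
      (1 + (p - 1) * p^2 + p * (p^2 / ?s p)) * (2 * p)) \<longlongrightarrow> 2 * (1 + 1 * 0) / (1 + inverse 1)) at_top"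
    by (rule Lim_transform_eventually)
  then show ?thesis by simp
qed

lemma symmetry_coeff_abs_power_scaled_limit:
  "((\<lambda>p. symmetry_coeff (abs_power p) * (2 * p)) \<longlongrightarrow> 1) at_top"
proof (rule tendsto_sandwich)
  let ?s = "\<lambda>p::real. p powr (2 / p)"
  show "\<forall>\<^sub>F p in at_top. inverse (2 * p - 1) * (2 * p) \<le> symmetry_coeff (abs_power p) * (2 * p)"
    using eventually_gt_at_top[of 2]
  proof eventually_elim
    case (elim p)
    then show ?case using symmetry_coeff_abs_power_ge[of p] by (intro mult_right_mono) auto
  qed
  show "\<forall>\<^sub>F p in at_top. symmetry_coeff (abs_power p) * (2 * p) \<le>
      (p^2 + (p - 1) + p * ?s p) / (1 + (p - 1) * p^2 + p * (p^2 / ?s p)) * (2 * p)"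
    using eventually_gt_at_top[of 2]
  proof eventually_elim
    case (elim p)
    have "?s p powr p = p^2" using elim by (simp add: powr_powr)
    moreover from this have "?s p powr (p - 1) = p^2 / ?s p"
      using elim by (simp add: powr_diff)
    moreover have "?s p > 0" using elim by simp
    ultimately show ?case
      using symmetry_coeff_abs_power_le[of p "?s p"] elim by (intro mult_right_mono) auto
  qed
  show "((\<lambda>p::real. inverse (2 * p - 1) * (2 * p)) \<longlongrightarrow> 1) at_top" by real_asymp
  show "((\<lambda>p. (p^2 + (p - 1) + p * ?s p) /
      (1 + (p - 1) * p^2 + p * (p^2 / ?s p)) * (2 * p)) \<longlongrightarrow> 1) at_top"
    by (rule test_ratio_limit)
qed

section \<open>The symmetry coefficient of a power function\<close>

theorem theorem4p2:
  shows "(\<forall>p\<in>{2<..}. symmetry_coeff (abs_power p) > inverse (2 * p)) \<and>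
    (\<forall>c\<in>{0<..<2}. \<exists>P\<in>{2<..}. \<forall>p\<in>{P<..}. symmetry_coeff (abs_power p) < inverse (c * p)) \<and>
    (\<lambda>p. symmetry_coeff (abs_power p)) \<sim>[at_top] (\<lambda>p. inverse (2 * p))"
proof (intro conjI ballI)
  fix p :: real
  assume "p \<in> {2<..}"
  then have "inverse (2 * p) < inverse (2 * p - 1)" by (simp add: field_simps)
  also have "\<dots> \<le> symmetry_coeff (abs_power p)"
    using \<open>p \<in> {2<..}\<close> by (intro symmetry_coeff_abs_power_ge) auto
  finally show "inverse (2 * p) < symmetry_coeff (abs_power p)" .
next
  fix c :: real
  assume c: "c \<in> {0<..<2}"
  then have "1 < 2 / c" by simp
  with symmetry_coeff_abs_power_scaled_limit
  have "\<forall>\<^sub>F p in at_top. symmetry_coeff (abs_power p) * (2 * p) < 2 / c"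
    by (rule order_tendstoD(2))
  then obtain P where P: "\<And>p. p \<ge> P \<Longrightarrow> symmetry_coeff (abs_power p) * (2 * p) < 2 / c"
    by (auto simp: eventually_at_top_linorder)
  show "\<exists>P\<in>{2<..}. \<forall>p\<in>{P<..}. symmetry_coeff (abs_power p) < inverse (c * p)"
  proof (intro bexI ballI)
    fix p assume "p \<in> {max P 3<..}"
    then have "p \<ge> P" "p > 0" by auto
    have "symmetry_coeff (abs_power p) < 2 / c / (2 * p)"
      by (rule iffD2[OF pos_less_divide_eq P]) (use \<open>p \<ge> P\<close> \<open>p > 0\<close> in simp_all)
    also have "\<dots> = inverse (c * p)" by (simp add: inverse_eq_divide)
    finally show "symmetry_coeff (abs_power p) < inverse (c * p)" .
  qed simp
next
  show "(\<lambda>p. symmetry_coeff (abs_power p)) \<sim>[at_top] (\<lambda>p. inverse (2 * p))"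
  proof (rule asymp_equivI')
    show "((\<lambda>p. symmetry_coeff (abs_power p) / inverse (2 * p)) \<longlongrightarrow> 1) at_top"
      using symmetry_coeff_abs_power_scaled_limit by (simp only: divide_inverse inverse_inverse_eq)
  qed
qed

end
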